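(* Let $n\ge 3$ be an integer divisible by $3$. Then the action of the dihedral group $D_6$ of order $6$ on $\mathbb{P}^2_{\mathbb{C}}$ induces an action of $D_6$ on the set $\mathcal{B}_n$ of triple points of the Böröczky configuration of size $n$; that is, $g\cdot\mathcal{B}_n=\mathcal{B}_n$ for every $g\in D_6$.
   Context: Böröczky configuration. For a real number $\theta$ let $P_\theta=(\cos\theta,\sin\theta)$ be the point of the unit circle in $\mathbb{R}^2$ with angle $\theta$. For $n\ge 3$ and $0\le j\le n-1$, let $L_j$ be the line through $P_{2\pi j/n}$ and $P_{\pi-4\pi j/n}$ if these points are distinct, and the tangent line to the unit circle at $P_{2\pi j/n}$ if they coincide. Let $\mathcal{L}_n=\{L_j: 0\le j\le n-1\}$. A triple point is a point of the plane where exactly three lines of $\mathcal{L}_n$ meet; $\mathcal{B}_n$ denotes the set of triple points, viewed in $\mathbb{P}^2_{\mathbb{C}}$ via $(a,b)\mapsto[a:b:1]$. $D_6$, the dihedral group of order $6$, acts on the affine plane as the symmetry group of an equilateral triangle centered at the origin, generated by the rotation by $2\pi/3$ about the origin and the reflection $(a,b)\mapsto(a,-b)$. The action on $\mathbb{P}^2_{\mathbb{C}}$ is $g\cdot[a:b:c]=[g(a,b):c]$. *)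

theory Defs
  imports "HOL-Analysis.Analysis" "HOL-Algebra.Generated_Groups" "HOL-Algebra.Group_Action"
begin

section \<open>The complex projective plane\<close>

text \<open>Points are the one-dimensional linear subspaces of \<open>\<complex>\<^sup>3\<close>; here
  \<^term>\<open>vec.span\<close> is the span over the field of scalars of the vectors, i.e. over the
  complex numbers (whereas \<open>span\<close> would be the real span).\<close>

definition P2C :: "(complex^3) set set" where
  "P2C = {vec.span {v} | v. v \<noteq> 0}"

definition hpoint :: "complex \<Rightarrow> complex \<Rightarrow> complex \<Rightarrow> (complex^3) set" where
  "hpoint a b c = vec.span {vector [a, b, c]}"

definition affine_point :: "real^2 \<Rightarrow> (complex^3) set" where
  "affine_point p = hpoint (complex_of_real (p$1)) (complex_of_real (p$2)) 1"

section \<open>The dihedral group of order 6 and its action\<close>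

definition GL2 :: "(real^2^2) monoid" where
  "GL2 = \<lparr>carrier = {A. invertible A}, mult = (**), one = mat 1\<rparr>"

definition rot_matrix :: "real \<Rightarrow> real^2^2" where
  "rot_matrix t = vector [vector [cos t, - sin t], vector [sin t, cos t]]"

definition refl_matrix :: "real^2^2" where
  "refl_matrix = vector [vector [1, 0], vector [0, -1]]"

definition D6 :: "(real^2^2) monoid" where
  "D6 = GL2\<lparr>carrier := generate GL2 {rot_matrix (2 * pi / 3), refl_matrix}\<rparr>"

definition extend_linear :: "real^2^2 \<Rightarrow> complex^3 \<Rightarrow> complex^3" where
  "extend_linear g v =
     (let w = map_matrix complex_of_real g *v vector [v$1, v$2] in vector [w$1, w$2, v$3])"

text \<open>A point of the projective plane is a set of vectors, so it is moved by taking its image;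
  \<open>proj_act_hpoint\<close> below is the description in homogeneous coordinates.\<close>

definition proj_act :: "real^2^2 \<Rightarrow> (complex^3) set \<Rightarrow> (complex^3) set" where
  "proj_act g x = extend_linear g ` x"

section \<open>The configuration\<close>

definition circle_point :: "real \<Rightarrow> real^2" where
  "circle_point t = vector [cos t, sin t]"

definition tangent_line :: "real^2 \<Rightarrow> (real^2) set" where
  "tangent_line p = {x. (x - p) \<bullet> p = 0}"

definition boroczky_line :: "nat \<Rightarrow> nat \<Rightarrow> (real^2) set" where
  "boroczky_line n j =
     (let p = circle_point (2 * pi * real j / real n);
          q = circle_point (pi - 4 * pi * real j / real n)
      in if p \<noteq> q then affine hull {p, q} else tangent_line p)"

definition boroczky_lines :: "nat \<Rightarrow> (real^2) set set" where
  "boroczky_lines n = boroczky_line n ` {0..n-1}"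

definition triple_points :: "nat \<Rightarrow> (real^2) set" where
  "triple_points n = {p. card {L \<in> boroczky_lines n. p \<in> L} = 3}"

definition boroczky_triple :: "nat \<Rightarrow> (complex^3) set set" where
  "boroczky_triple n = affine_point ` triple_points n"

section \<open>Basic facts\<close>

lemma extend_linear_vector:
  "extend_linear g (vector [a, b, c]) =
     vector [complex_of_real (g$1$1) * a + complex_of_real (g$1$2) * b,
             complex_of_real (g$2$1) * a + complex_of_real (g$2$2) * b, c]"
  by (simp add: extend_linear_def matrix_vector_mult_def sum_2 Let_def)

lemma extend_linear_scale: "extend_linear g (k *s v) = k *s extend_linear g v"
  by (simp add: extend_linear_def matrix_vector_mult_def sum_2 Let_def vec_eq_iff forall_3
      algebra_simps)

lemma extend_linear_mult: "extend_linear (g ** h) v = extend_linear g (extend_linear h v)"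
  by (simp add: extend_linear_def matrix_vector_mult_def matrix_matrix_mult_def sum_2 Let_def
      vec_eq_iff forall_3 algebra_simps)

lemma extend_linear_one: "extend_linear (mat 1) v = v"
  by (simp add: extend_linear_def matrix_vector_mult_def mat_def sum_2 Let_def
      vec_eq_iff forall_3)

lemma proj_act_span: "proj_act g (vec.span {v}) = vec.span {extend_linear g v}"
  by (auto simp: proj_act_def vec.span_singleton extend_linear_scale image_iff)

lemma proj_act_mult: "proj_act (g ** h) x = proj_act g (proj_act h x)"
  by (simp add: proj_act_def image_image extend_linear_mult)

lemma proj_act_one: "proj_act (mat 1) x = x"
  by (simp add: proj_act_def extend_linear_one)

lemma proj_act_hpoint:
  "proj_act g (hpoint a b c) =
     hpoint (complex_of_real (g$1$1) * a + complex_of_real (g$1$2) * b)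
            (complex_of_real (g$2$1) * a + complex_of_real (g$2$2) * b) c"
  by (simp add: hpoint_def proj_act_span extend_linear_vector)

lemma proj_act_affine_point: "proj_act g (affine_point p) = affine_point (g *v p)"
  by (simp add: affine_point_def proj_act_hpoint matrix_vector_mult_def sum_2)

lemma group_GL2: "group GL2"
proof (rule groupI)
  fix A assume "A \<in> carrier GL2"
  then obtain B where B: "A ** B = mat 1" "B ** A = mat 1"
    by (auto simp: GL2_def invertible_def)
  then have "invertible B" by (auto simp: invertible_def)
  with B show "\<exists>B\<in>carrier GL2. B \<otimes>\<^bsub>GL2\<^esub> A = \<one>\<^bsub>GL2\<^esub>" by (auto simp: GL2_def)
qed (auto simp: GL2_def invertible_mult matrix_mul_assoc invertible_def[of "mat 1"])

lemma generators_in_GL2: "{rot_matrix t, refl_matrix} \<subseteq> carrier GL2"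
proof -
  have "det (rot_matrix t) = 1"
    by (simp add: det_2 rot_matrix_def flip: power2_eq_square)
  moreover have "det refl_matrix = -1" by (simp add: det_2 refl_matrix_def)
  ultimately show ?thesis by (auto simp: GL2_def invertible_det_nz)
qed

lemma subgroup_D6: "subgroup (carrier D6) GL2"
  unfolding D6_def using group.generate_is_subgroup[OF group_GL2 generators_in_GL2] by simp

lemma group_D6: "group D6"
  using group.subgroup_imp_group[OF group_GL2 subgroup_D6] by (simp add: D6_def)

lemma order_D6: "order D6 = 6"
proof -
  define M :: "real \<Rightarrow> real \<Rightarrow> real \<Rightarrow> real^2^2" where
    "M e c s = vector [vector [c, - e * s], vector [s, e * c]]" for e c s
  define k where "k = sqrt 3 / 2"
  have k: "k * k = 3/4" "k \<noteq> 0" "k \<noteq> -k" "-k \<noteq> k" by (auto simp: k_def)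
  define S where "S = {M 1 1 0, M 1 (-(1/2)) k, M 1 (-(1/2)) (-k),
    M (-1) 1 0, M (-1) (-(1/2)) k, M (-1) (-(1/2)) (-k)}"
  have M_mult: "M e c s ** M e' c' s' = M (e * e') (c * c' - e * s * s') (s * c' + e * c * s')"
    if "e * e = 1" for e c s e' c' s'
    using that by (simp add: M_def vec_eq_iff forall_2 matrix_matrix_mult_def sum_2 algebra_simps)
  have M_one: "M 1 1 0 = mat 1"
    by (simp add: M_def vec_eq_iff forall_2 mat_def)
  have gens: "rot_matrix (2 * pi / 3) = M 1 (-(1/2)) k" "refl_matrix = M (-1) 1 0"
    unfolding rot_matrix_def cos_120 sin_120 by (simp_all add: M_def refl_matrix_def k_def)
  have closed: "A ** B \<in> S" if "A \<in> S" "B \<in> S" for A B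
    using that unfolding S_def by (auto simp: M_mult k)
  let ?G = "generate GL2 {M 1 (-(1/2)) k, M (-1) 1 0}"
  have GL2: "M 1 (-(1/2)) k \<in> carrier GL2" "M (-1) 1 0 \<in> carrier GL2"
    using generators_in_GL2[of "2 * pi / 3"] by (auto simp: gens)
  have mul: "x ** y \<in> ?G" if "x \<in> ?G" "y \<in> ?G" for x y
    using generate.eng[OF that] by (simp add: GL2_def)
  have r: "M 1 (-(1/2)) k \<in> ?G" and s: "M (-1) 1 0 \<in> ?G" and o: "M 1 1 0 \<in> ?G"
    using generate.one[of GL2] by (auto intro: generate.incl simp: M_one GL2_def)
  have r2: "M 1 (-(1/2)) (-k) \<in> ?G" using mul[OF r r] by (simp add: M_mult k)
  have "?G \<subseteq> carrier GL2"
    using group.generate_incl[OF group_GL2] GL2 by simp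
  with r2 have GL2': "M 1 (-(1/2)) (-k) \<in> carrier GL2" by blast
  have inv1: "m_inv GL2 (M 1 (-(1/2)) k) = M 1 (-(1/2)) (-k)"
    by (rule group.inv_equality[OF group_GL2 _ GL2(1) GL2'])
       (simp add: GL2_def M_mult k flip: M_one)
  have inv2: "m_inv GL2 (M (-1) 1 0) = M (-1) 1 0"
    by (rule group.inv_equality[OF group_GL2 _ GL2(2) GL2(2)])
       (simp add: GL2_def M_mult flip: M_one)
  have "x \<in> S" if "x \<in> ?G" for x
    using that
  proof induction
    case one
    then show ?case by (simp add: GL2_def S_def flip: M_one)
  next
    case (eng h1 h2)
    then show ?case using closed by (simp add: GL2_def)
  qed (auto simp: S_def inv1 inv2)
  moreover have "S \<subseteq> ?G"
    using r s o r2 mul[OF r s] mul[OF r2 s] by (simp add: S_def M_mult)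
  ultimately have "carrier D6 = S" by (auto simp: D6_def gens)
  moreover have M_eq: "M e c s = M e' c' s' \<longleftrightarrow> c = c' \<and> s = s' \<and> e * s = e' * s' \<and> e * c = e' * c'"
    for e c s e' c' s'
    by (auto simp: M_def vec_eq_iff forall_2)
  have "card S = 6"
    unfolding S_def using k by (simp add: M_eq)
  ultimately show ?thesis by (simp add: order_def)
qed

lemma proj_act_P2C:
  assumes "invertible g" "x \<in> P2C"
  shows "proj_act g x \<in> P2C"
proof -
  obtain v where v: "x = vec.span {v}" "v \<noteq> 0" using assms(2) by (auto simp: P2C_def)
  obtain h where h: "h ** g = mat 1" using assms(1) by (auto simp: invertible_def)
  have "extend_linear g v \<noteq> 0"
  proof
    assume "extend_linear g v = 0"
    moreover have "extend_linear h 0 = 0" using extend_linear_scale[of h 0 0] by simp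
    ultimately have "extend_linear (h ** g) v = 0" by (simp add: extend_linear_mult)
    with h v show False by (simp add: extend_linear_one)
  qed
  with v show ?thesis by (auto simp: P2C_def proj_act_span)
qed

lemma group_action_D6_P2C: "group_action D6 P2C (\<lambda>g. \<lambda>x\<in>P2C. proj_act g x)"
proof -
  have inv: "invertible g" if "g \<in> carrier D6" for g
    using that subgroup.subset[OF subgroup_D6] by (auto simp: GL2_def)
  have bij: "(\<lambda>x\<in>P2C. proj_act g x) \<in> Bij P2C" if g: "g \<in> carrier D6" for g
  proof -
    obtain h where h: "g ** h = mat 1" "h ** g = mat 1"
      using inv[OF g] by (auto simp: invertible_def)
    then have "invertible h" by (auto simp: invertible_def)
    have "bij_betw (proj_act g) P2C P2C"
      by (rule bij_betw_byWitness[where f' = "proj_act h"])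
         (use h inv[OF g] \<open>invertible h\<close> in
           \<open>auto simp: proj_act_P2C proj_act_one simp flip: proj_act_mult\<close>)
    then show ?thesis by (simp add: Bij_def)
  qed
  have "(\<lambda>g. \<lambda>x\<in>P2C. proj_act g x) \<in> hom D6 (BijGroup P2C)"
  proof (rule homI)
    fix g h assume gh: "g \<in> carrier D6" "h \<in> carrier D6"
    have mult: "g \<otimes>\<^bsub>D6\<^esub> h = g ** h" by (simp add: D6_def GL2_def)
    have "compose P2C (\<lambda>x\<in>P2C. proj_act g x) (\<lambda>x\<in>P2C. proj_act h x) =
        (\<lambda>x\<in>P2C. proj_act (g ** h) x)"
      unfolding compose_def
      by (rule restrict_ext) (simp add: proj_act_mult proj_act_P2C inv[OF gh(2)])
    then show "(\<lambda>x\<in>P2C. proj_act (g \<otimes>\<^bsub>D6\<^esub> h) x) =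
        (\<lambda>x\<in>P2C. proj_act g x) \<otimes>\<^bsub>BijGroup P2C\<^esub> (\<lambda>x\<in>P2C. proj_act h x)"
      unfolding mult BijGroup_def using bij[OF gh(1)] bij[OF gh(2)] by simp
  qed (simp add: BijGroup_def bij)
  then show ?thesis
    by (simp add: group_action_def group_hom_def group_hom_axioms_def group_D6 group_BijGroup)
qed

end

theory Submission
  imports Defs
begin

text \<open>
  The line \<open>L\<^sub>j\<close> joins the points of the circle with angles \<open>t = 2\<pi>j/n\<close> and \<open>\<pi> - 2t\<close>. Rotating by
  \<open>2\<pi>/3\<close> replaces \<open>t\<close> by \<open>u = t + 2\<pi>/3\<close> and the second angle by \<open>\<pi> - 2t + 2\<pi>/3 = \<pi> - 2u + 2\<pi>\<close>, so
  it maps \<open>L\<^sub>j\<close> to \<open>L\<^sub>j\<^sub>+\<^sub>n\<^sub>/\<^sub>3\<close>, indices being taken modulo \<open>n\<close>; the reflection maps \<open>L\<^sub>j\<close> to \<open>L\<^sub>-\<^sub>j\<close>.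
  The generators of the dihedral group thus permute the lines, hence also the triple points.
\<close>

text \<open>Parametrizing by a real angle turns the rotation into a shift of \<open>t\<close> and
  the reflection into a change of sign.\<close>

definition circle_line :: "real \<Rightarrow> (real^2) set" where
  "circle_line t =
     (if circle_point t \<noteq> circle_point (pi - 2 * t)
      then affine hull {circle_point t, circle_point (pi - 2 * t)}
      else tangent_line (circle_point t))"

lemma boroczky_line_eq_circle_line:
  "boroczky_line n j = circle_line (2 * pi * real j / real n)"
proof -
  have "4 * pi * real j / real n = 2 * (2 * pi * real j / real n)" by simp
  then show ?thesis by (simp only: boroczky_line_def circle_line_def Let_def)
qed

lemma circle_point_periodic: "circle_point (t + 2 * pi * of_int k) = circle_point t"
  using sin_cos_eq_iff[of "t + 2 * pi * of_int k" t] by (auto simp: circle_point_def)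

lemma circle_line_periodic: "circle_line (t + 2 * pi * of_int k) = circle_line t"
proof -
  have "pi - 2 * (t + 2 * pi * of_int k) = (pi - 2 * t) + 2 * pi * of_int (-2 * k)"
    by (simp add: algebra_simps)
  then show ?thesis
    unfolding circle_line_def by (simp only: circle_point_periodic)
qed

text \<open>By periodicity the index may run over all integers, where adding \<open>n/3\<close> and
  negating are honest bijections and no reduction modulo \<open>n\<close> is needed.\<close>

lemma boroczky_lines_eq_range:
  assumes "n > 0"
  shows "boroczky_lines n = range (\<lambda>k::int. circle_line (2 * pi * of_int k / real n))"
proof (intro equalityI subsetI)
  fix L assume "L \<in> boroczky_lines n"
  then obtain j where "L = boroczky_line n j" by (auto simp: boroczky_lines_def)
  then have "L = circle_line (2 * pi * of_int (int j) / real n)"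
    by (simp add: boroczky_line_eq_circle_line)
  then show "L \<in> range (\<lambda>k::int. circle_line (2 * pi * of_int k / real n))" by blast
next
  fix L assume "L \<in> range (\<lambda>k::int. circle_line (2 * pi * of_int k / real n))"
  then obtain k :: int where L: "L = circle_line (2 * pi * of_int k / real n)" by blast
  \<comment> \<open>The quotient \<open>k div int n\<close> counts the full turns separating the
    angles of index \<open>k\<close> and index \<open>j\<close>.\<close>
  define j where "j = nat (k mod int n)"
  have "k = int j + int n * (k div int n)"
    using assms by (simp add: j_def)
  then have "real_of_int k = real j + real n * of_int (k div int n)"
    by (metis of_int_add of_int_mult of_int_of_nat_eq)
  then have "2 * pi * of_int k / real n
      = 2 * pi * real j / real n + 2 * pi * of_int (k div int n)"
    using assms by (simp add: field_simps)
  then have "L = boroczky_line n j"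
    by (simp only: L circle_line_periodic boroczky_line_eq_circle_line)
  moreover have "k mod int n < int n"
    using assms by simp
  then have "j \<in> {0..n-1}"
    using assms by (simp add: j_def nat_le_iff of_nat_diff)
  ultimately show "L \<in> boroczky_lines n" by (simp add: boroczky_lines_def)
qed

text \<open>Preserved inner products carry the defining equation over in both directions;
  surjectivity supplies the preimages.\<close>

lemma tangent_line_image:
  assumes "orthogonal_transformation f"
  shows "f ` tangent_line p = tangent_line (f p)"
proof -
  have "(f x - f p) \<bullet> f p = (x - p) \<bullet> p" for x
    using assms by (simp add: orthogonal_transformation_def flip: linear_diff)
  then show ?thesis
    using orthogonal_transformation_surj[OF assms]
    by (auto simp: tangent_line_def image_iff) (metis surj_def)
qed

text \<open>A linear map commutes with affine hulls, and by injectivity the tangent case occurs for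
  \<open>t\<close> exactly when it occurs for \<open>u\<close>.\<close>

lemma circle_line_image:
  assumes "orthogonal_transformation f"
    and "f (circle_point t) = circle_point u"
    and "f (circle_point (pi - 2 * t)) = circle_point (pi - 2 * u)"
  shows "f ` circle_line t = circle_line u"
proof -
  have lin: "linear f" and inj: "inj f"
    using assms(1) by (auto simp: orthogonal_transformation_linear orthogonal_transformation_inj)
  have "f ` (affine hull S) = affine hull (f ` S)" for S
    using affine_hull_linear_image[OF linear_conv_bounded_linear[THEN iffD1, OF lin]] by metis
  moreover have "circle_point t = circle_point (pi - 2 * t)
      \<longleftrightarrow> circle_point u = circle_point (pi - 2 * u)"
    using assms(2,3) inj by (metis injD)
  ultimately show ?thesis
    by (simp add: circle_line_def tangent_line_image assms)
qed

lemma rot_matrix_circle_point: "rot_matrix s *v circle_point t = circle_point (t + s)"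
  by (simp add: rot_matrix_def circle_point_def matrix_vector_mult_def sum_2 vec_eq_iff forall_2
      cos_add sin_add algebra_simps)

lemma refl_matrix_circle_point: "refl_matrix *v circle_point t = circle_point (- t)"
  by (simp add: refl_matrix_def circle_point_def matrix_vector_mult_def sum_2 vec_eq_iff forall_2)

lemma orthogonal_rot_matrix: "orthogonal_transformation ((*v) (rot_matrix s))"
proof -
  \<comment> \<open>This and the next fact put \<open>cos\<^sup>2 + sin\<^sup>2 = 1\<close> into the
    right-nested shapes that \<open>algebra_simps\<close> produces.\<close>
  have pythagoras: "cos s * (cos s * x) + sin s * (sin s * x) = x" for x
    by (simp flip: mult.assoc distrib_right power2_eq_square)
  have pythagoras_add: "cos s * (cos s * x) + (sin s * (sin s * x) + y) = x + y" for x y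
    unfolding add.assoc[symmetric] pythagoras ..
  show ?thesis
    unfolding orthogonal_transformation_def
    by (simp add: rot_matrix_def matrix_vector_mult_def sum_2 inner_vec_def algebra_simps
        pythagoras pythagoras_add)
qed

lemma orthogonal_refl_matrix: "orthogonal_transformation ((*v) refl_matrix)"
  unfolding orthogonal_transformation_def
  by (simp add: refl_matrix_def matrix_vector_mult_def sum_2 inner_vec_def)

lemma rot_matrix_circle_line:
  "(*v) (rot_matrix (2 * pi / 3)) ` circle_line t = circle_line (t + 2 * pi / 3)"
proof (rule circle_line_image[OF orthogonal_rot_matrix])
  have "pi - 2 * t + 2 * pi / 3 = pi - 2 * (t + 2 * pi / 3) + 2 * pi * of_int 1"
    by simp
  then show "rot_matrix (2 * pi / 3) *v circle_point (pi - 2 * t)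
      = circle_point (pi - 2 * (t + 2 * pi / 3))"
    by (simp only: rot_matrix_circle_point circle_point_periodic)
qed (rule rot_matrix_circle_point)

lemma refl_matrix_circle_line: "(*v) refl_matrix ` circle_line t = circle_line (- t)"
proof (rule circle_line_image[OF orthogonal_refl_matrix])
  \<comment> \<open>The negated second angle falls short of the one belonging to \<open>- t\<close>
    by one full turn.\<close>
  have "- (pi - 2 * t) = pi - 2 * (- t) + 2 * pi * of_int (-1)"
    by simp
  then show "refl_matrix *v circle_point (pi - 2 * t) = circle_point (pi - 2 * (- t))"
    by (simp only: refl_matrix_circle_point circle_point_periodic)
qed (rule refl_matrix_circle_point)

lemma rot_matrix_boroczky_lines:
  assumes "n > 0" and "3 dvd n"
  shows "(`) ((*v) (rot_matrix (2 * pi / 3))) ` boroczky_lines n = boroczky_lines n"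
proof -
  obtain m where m: "n = 3 * m" using assms(2) by blast
  \<comment> \<open>Divisibility by 3 enters here: a third of a turn is exactly \<open>m\<close>
    steps of size \<open>2 * pi / n\<close>.\<close>
  have shift: "2 * pi * of_int k / real n + 2 * pi / 3 = 2 * pi * of_int (k + int m) / real n"
    for k using assms(1) by (simp add: m field_simps)
  have "surj (\<lambda>k. k + int m)"
    by (rule surjI[where f = "\<lambda>k. k - int m"]) simp
  moreover have "(`) ((*v) (rot_matrix (2 * pi / 3))) ` boroczky_lines n
      = (\<lambda>k. circle_line (2 * pi * of_int k / real n)) ` range (\<lambda>k. k + int m)"
    unfolding boroczky_lines_eq_range[OF assms(1)] image_image rot_matrix_circle_line shift ..
  ultimately show ?thesis
    by (simp add: boroczky_lines_eq_range[OF assms(1)])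
qed

lemma refl_matrix_boroczky_lines:
  assumes "n > 0"
  shows "(`) ((*v) refl_matrix) ` boroczky_lines n = boroczky_lines n"
proof -
  have neg: "- (2 * pi * of_int k / real n) = 2 * pi * of_int (- k) / real n" for k
    by simp
  have "(`) ((*v) refl_matrix) ` boroczky_lines n
      = (\<lambda>k. circle_line (2 * pi * of_int k / real n)) ` range uminus"
    unfolding boroczky_lines_eq_range[OF assms] image_image refl_matrix_circle_line neg ..
  then show ?thesis
    by (simp add: boroczky_lines_eq_range[OF assms] surj_uminus)
qed

text \<open>Taking images under \<open>f\<close> matches the lines through \<open>p\<close>
  bijectively with those through \<open>f p\<close>, so both points have the same
  multiplicity.\<close>

lemma triple_points_image:
  assumes "bij f" and lines: "(`) f ` boroczky_lines n = boroczky_lines n"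
  shows "f ` triple_points n = triple_points n"
proof -
  have inj: "inj f" using assms(1) by (rule bij_is_inj)
  have "{L \<in> boroczky_lines n. f p \<in> L} = (`) f ` {L \<in> boroczky_lines n. p \<in> L}" for p
    by (subst lines[symmetric]) (use inj in \<open>auto dest: injD\<close>)
  then have "card {L \<in> boroczky_lines n. f p \<in> L} = card {L \<in> boroczky_lines n. p \<in> L}" for p
    by (simp add: card_image inj_on_def inj_image_eq_iff[OF inj])
  then have "f p \<in> triple_points n \<longleftrightarrow> p \<in> triple_points n" for p
    by (simp add: triple_points_def)
  then show ?thesis
    using bij_is_surj[OF assms(1)] by (auto simp: image_iff) (metis surj_def)
qed

text \<open>The embedding \<open>affine_point\<close> intertwines the linear and the projective
  action, so invariance passes from the real plane to the projective one.\<close>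

lemma proj_act_boroczky_triple:
  assumes "orthogonal_transformation ((*v) g)"
    and "(`) ((*v) g) ` boroczky_lines n = boroczky_lines n"
  shows "proj_act g ` boroczky_triple n = boroczky_triple n"
proof -
  have "proj_act g ` boroczky_triple n = affine_point ` (*v) g ` triple_points n"
    by (simp add: boroczky_triple_def image_image proj_act_affine_point)
  then show ?thesis
    using triple_points_image[OF orthogonal_transformation_bij[OF assms(1)] assms(2)]
    by (simp add: boroczky_triple_def)
qed

text \<open>This reduces invariance under the whole dihedral group to its two generators.\<close>

lemma subgroup_proj_act_stabilizer:
  "subgroup {g \<in> carrier GL2. proj_act g ` X = X} GL2"
proof -
  interpret group GL2 by (rule group_GL2)
  have mult: "proj_act (g \<otimes>\<^bsub>GL2\<^esub> h) ` X = proj_act g ` proj_act h ` X" for g h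
    by (simp add: GL2_def proj_act_mult image_image)
  have one: "proj_act \<one>\<^bsub>GL2\<^esub> ` X = X"
    by (simp add: GL2_def proj_act_one)
  show ?thesis
  proof (rule subgroupI)
    fix g assume g: "g \<in> {g \<in> carrier GL2. proj_act g ` X = X}"
    \<comment> \<open>The set \<open>X\<close> on the left is replaced by its equal image under
      \<open>g\<close>.\<close>
    then have "proj_act (inv\<^bsub>GL2\<^esub> g) ` X = proj_act (inv\<^bsub>GL2\<^esub> g \<otimes>\<^bsub>GL2\<^esub> g) ` X"
      unfolding mult by simp
    with g show "inv\<^bsub>GL2\<^esub> g \<in> {g \<in> carrier GL2. proj_act g ` X = X}"
      by (simp add: one)
  qed (use one in \<open>auto simp: mult\<close>)
qed

text \<open>Each group element is injective on \<open>X\<close> by its inverse matrix and maps onto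
  \<open>X\<close> by invariance. The maps are restricted to \<open>X\<close> because
  \<open>Bij X\<close> consists of functions extensional on \<open>X\<close>.\<close>

lemma group_action_D6_invariant:
  assumes inv: "\<And>g. g \<in> carrier D6 \<Longrightarrow> proj_act g ` X = X"
  shows "group_action D6 X (\<lambda>g. \<lambda>x\<in>X. proj_act g x)"
proof -
  have bij: "(\<lambda>x\<in>X. proj_act g x) \<in> Bij X" if g: "g \<in> carrier D6" for g
  proof -
    obtain h where h: "h ** g = mat 1"
      using g subgroup.subset[OF subgroup_D6] by (auto simp: GL2_def invertible_def)
    have "inj_on (proj_act g) X"
      by (rule inj_on_inverseI[where g = "proj_act h"])
        (simp add: h proj_act_one flip: proj_act_mult)
    with inv[OF g] show ?thesis by (simp add: Bij_def bij_betw_def)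
  qed
  have "(\<lambda>g. \<lambda>x\<in>X. proj_act g x) \<in> hom D6 (BijGroup X)"
  proof (rule homI)
    fix g h assume gh: "g \<in> carrier D6" "h \<in> carrier D6"
    \<comment> \<open>Invariance under \<open>h\<close> keeps the inner value in \<open>X\<close>,
      where the outer restricted map agrees with \<open>proj_act g\<close>.\<close>
    have "compose X (\<lambda>x\<in>X. proj_act g x) (\<lambda>x\<in>X. proj_act h x) = (\<lambda>x\<in>X. proj_act (g ** h) x)"
      unfolding compose_def
      by (rule restrict_ext) (use inv[OF gh(2)] in \<open>auto simp: proj_act_mult\<close>)
    then show "(\<lambda>x\<in>X. proj_act (g \<otimes>\<^bsub>D6\<^esub> h) x) =
        (\<lambda>x\<in>X. proj_act g x) \<otimes>\<^bsub>BijGroup X\<^esub> (\<lambda>x\<in>X. proj_act h x)"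
      using bij[OF gh(1)] bij[OF gh(2)] by (simp add: BijGroup_def D6_def GL2_def)
  qed (simp add: BijGroup_def bij)
  then show ?thesis
    by (simp add: group_action_def group_hom_def group_hom_axioms_def group_D6 group_BijGroup)
qed

theorem proposition3p2:
  fixes n :: nat
  assumes "n \<ge> 3" and "3 dvd n"
  shows "(\<forall>g\<in>carrier D6. proj_act g ` boroczky_triple n = boroczky_triple n) \<and>
         group_action D6 (boroczky_triple n) (\<lambda>g. \<lambda>x\<in>boroczky_triple n. proj_act g x)"
proof -
  have "n > 0" using assms(1) by simp
  have "proj_act (rot_matrix (2 * pi / 3)) ` boroczky_triple n = boroczky_triple n"
    by (intro proj_act_boroczky_triple orthogonal_rot_matrix rot_matrix_boroczky_lines
        \<open>n > 0\<close> assms(2))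
  moreover have "proj_act refl_matrix ` boroczky_triple n = boroczky_triple n"
    by (intro proj_act_boroczky_triple orthogonal_refl_matrix refl_matrix_boroczky_lines \<open>n > 0\<close>)
  \<comment> \<open>The stabilizer of the triple points is a subgroup containing both generators,
    hence all that they generate.\<close>
  ultimately have "generate GL2 {rot_matrix (2 * pi / 3), refl_matrix}
      \<subseteq> {g \<in> carrier GL2. proj_act g ` boroczky_triple n = boroczky_triple n}"
    using generators_in_GL2
    by (intro group.generate_subgroup_incl[OF group_GL2 _ subgroup_proj_act_stabilizer]) auto
  then have "proj_act g ` boroczky_triple n = boroczky_triple n" if "g \<in> carrier D6" for g
    using that by (auto simp: D6_def)
  then show ?thesis
    using group_action_D6_invariant by blast
qed

end
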